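(* Let $A\subset B$ be an integral ring extension of integral domains, let $K$ and $L$ be the fields of fractions of $A$ and $B$, respectively, and let $\overline{A}$ be the integral closure of $A$ in $K$. Then, for every $b\in B$, $\mathrm{id}_K(b)=\mathrm{id}_{\overline{A}}(b)$. In particular, if $A$ is integrally closed, then $\mathrm{d}_K(L)=\mathrm{d}_A(B)$.
   Context: All rings are commutative with unity. For a domain $R$ contained in a domain $S$ and an element $b\in S$ integral over $R$, the integral degree of $b$ over $R$, denoted $\mathrm{id}_R(b)$, is the minimum integer $n\geq 1$ such that $b$ is a root of a monic polynomial of degree $n$ in $R[T]$. If $R\subset S$ is integral, the integral degree of $S$ over $R$ is $\mathrm{d}_R(S)=\sup\{\mathrm{id}_R(b)\mid b\in S\}$ (possibly $\infty$). A domain $A$ is integrally closed if $A=\overline{A}$. *)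

theory Defs
  imports
    "HOL-Computational_Algebra.Computational_Algebra"
    "HOL-Library.Extended_Nat"
begin

text \<open>
  Rings are rendered as unital subrings (sets) of an ambient type. For an integral domain
  \<open>R \<subseteq> 'a\<close>, the field of fractions of \<open>R\<close> is taken inside the library's field of
  fractions \<open>'a fract\<close>, with \<open>to_fract\<close> as the embedding of \<open>'a\<close>.
\<close>

definition is_subring :: "'a::comm_ring_1 set \<Rightarrow> bool" where
  "is_subring R \<longleftrightarrow> 0 \<in> R \<and> 1 \<in> R \<and>
     (\<forall>x\<in>R. - x \<in> R) \<and> (\<forall>x\<in>R. \<forall>y\<in>R. x + y \<in> R) \<and> (\<forall>x\<in>R. \<forall>y\<in>R. x * y \<in> R)"

definition monic_over :: "'a::comm_ring_1 set \<Rightarrow> 'a poly \<Rightarrow> bool" where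
  "monic_over R p \<longleftrightarrow> (\<forall>i. coeff p i \<in> R) \<and> lead_coeff p = 1"

definition integral_over :: "'a::comm_ring_1 set \<Rightarrow> 'a \<Rightarrow> bool" where
  "integral_over R b \<longleftrightarrow> (\<exists>p. monic_over R p \<and> poly p b = 0)"

definition integral_extension :: "'a::comm_ring_1 set \<Rightarrow> 'a set \<Rightarrow> bool" where
  "integral_extension R S \<longleftrightarrow>
     is_subring R \<and> is_subring S \<and> R \<subseteq> S \<and> (\<forall>b\<in>S. integral_over R b)"

text \<open>Meaningful only for \<open>b\<close> integral over \<open>R\<close>; otherwise the \<open>LEAST\<close> is unspecified.\<close>

definition int_degree :: "'a::comm_ring_1 set \<Rightarrow> 'a \<Rightarrow> nat" where
  "int_degree R b =
     (LEAST n. 1 \<le> n \<and> (\<exists>p. monic_over R p \<and> degree p = n \<and> poly p b = 0))"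

text \<open>Meaningful only for \<open>S\<close> integral over \<open>R\<close>.\<close>

definition ext_int_degree :: "'a::comm_ring_1 set \<Rightarrow> 'a set \<Rightarrow> enat" where
  "ext_int_degree R S = (SUP b\<in>S. enat (int_degree R b))"

definition fraction_field :: "'a::idom set \<Rightarrow> 'a fract set" where
  "fraction_field R = {Fract x y | x y. x \<in> R \<and> y \<in> R \<and> y \<noteq> 0}"

definition integral_closure_in :: "'a::comm_ring_1 set \<Rightarrow> 'a set \<Rightarrow> 'a set" where
  "integral_closure_in R S = {x \<in> S. integral_over R x}"

definition normalization_of :: "'a::idom set \<Rightarrow> 'a fract set" where
  "normalization_of R = integral_closure_in (to_fract ` R) (fraction_field R)"

definition integrally_closed :: "'a::idom set \<Rightarrow> bool" where
  "integrally_closed R \<longleftrightarrow> to_fract ` R = normalization_of R"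

end

theory Submission
  imports "HOL-Algebra.Algebraic_Closure_Type" "Jordan_Normal_Form.Char_Poly" Defs
begin

text \<open>
  A monic polynomial \<open>g\<close> of least degree over \<open>K\<close> annihilating \<open>b\<close> divides every monic
  polynomial over \<open>A\<close> annihilating \<open>b\<close>. Hence all roots of \<open>g\<close> in an algebraic closure are
  integral over \<open>A\<close>, and so are the coefficients of \<open>g\<close>, being sums of products of roots;
  thus \<open>g\<close> has coefficients in the normalization of \<open>A\<close>. For the second claim, every
  element of \<open>L\<close> can be written \<open>b / a\<close> with \<open>b \<in> B\<close> and \<open>a \<in> A\<close>, and dividing by
  \<open>a \<in> K\<close> does not raise the degree over \<open>K\<close>.
\<close>

section \<open>Subrings\<close>

lemma is_subringD:
  assumes "is_subring R"
  shows "0 \<in> R" "1 \<in> R" "x \<in> R \<Longrightarrow> - x \<in> R" "x \<in> R \<Longrightarrow> y \<in> R \<Longrightarrow> x + y \<in> R"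
    "x \<in> R \<Longrightarrow> y \<in> R \<Longrightarrow> x * y \<in> R"
  using assms unfolding is_subring_def by auto

lemma is_subring_diff: "is_subring R \<Longrightarrow> x \<in> R \<Longrightarrow> y \<in> R \<Longrightarrow> x - y \<in> R"
  using is_subringD(3,4)[of R] by (metis diff_conv_add_uminus)

lemma is_subring_sum:
  assumes "is_subring R" "\<And>i. i \<in> I \<Longrightarrow> f i \<in> R"
  shows "sum f I \<in> R"
  using assms(2) by (induction I rule: infinite_finite_induct) (auto intro: is_subringD[OF assms(1)])

lemma is_subring_prod:
  assumes "is_subring R" "\<And>i. i \<in> I \<Longrightarrow> f i \<in> R"
  shows "prod f I \<in> R"
  using assms(2) by (induction I rule: infinite_finite_induct) (auto intro: is_subringD[OF assms(1)])

lemma is_subring_prod_mset: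
  assumes "is_subring R" "\<And>i. i \<in># M \<Longrightarrow> f i \<in> R"
  shows "(\<Prod>i\<in>#M. f i) \<in> R"
  using assms(2) by (induction M) (auto intro: is_subringD[OF assms(1)])

lemma is_subring_image:
  assumes "inj_comm_ring_hom h" "is_subring R"
  shows "is_subring (h ` R)"
proof -
  interpret inj_comm_ring_hom h by fact
  show ?thesis
    unfolding is_subring_def
  proof (intro conjI ballI)
    show "0 \<in> h ` R" "1 \<in> h ` R"
      using is_subringD(1,2)[OF assms(2)] by (metis hom_zero image_eqI, metis hom_one image_eqI)
  qed (auto simp flip: hom_uminus hom_add hom_mult intro!: imageI is_subringD[OF assms(2)])
qed

text \<open>Treating the polynomials over \<open>R\<close> as a subring makes the closure lemmas for
  products and determinants available for characteristic polynomials and products of linear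
  factors.\<close>

lemma is_subring_polys:
  assumes "is_subring R"
  shows "is_subring {p. \<forall>i. coeff p i \<in> R}"
  unfolding is_subring_def
  by (auto simp: coeff_mult coeff_1 intro!: is_subringD[OF assms] is_subring_sum[OF assms])

text \<open>By the Leibniz formula the determinant is a sum of signed products of entries, and the
  signs 1 and -1 lie in \<open>R\<close>.\<close>

lemma det_in_subring:
  assumes "is_subring R" "A \<in> carrier_mat n n"
    and "\<And>i j. i < n \<Longrightarrow> j < n \<Longrightarrow> A $$ (i, j) \<in> R"
  shows "det A \<in> R"
  unfolding det_def'[OF assms(2)]
proof (intro is_subring_sum[OF assms(1)] is_subringD(5)[OF assms(1)] is_subring_prod[OF assms(1)])
  fix p i assume "p \<in> {p. p permutes {0..<n}}" "i \<in> {0..<n}"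
  then show "A $$ (i, p i) \<in> R"
    by (intro assms(3)) (auto simp: permutes_in_image)
next
  fix p :: "nat \<Rightarrow> nat"
  show "signof p \<in> R"
    using is_subringD(2,3)[OF assms(1)] by (auto simp: sign_def)
qed

section \<open>Elements integral over a subring\<close>

text \<open>The only constant monic polynomial is 1, which has no root. This supplies the bound
  \<open>1 \<le> n\<close> in \<open>int_degree\<close>.\<close>

lemma monic_over_degree_pos:
  assumes "monic_over R p" "poly p b = 0"
  shows "degree p > 0"
proof (rule ccontr)
  assume "\<not> degree p > 0"
  then obtain c where "p = [:c:]" using degree_eq_zeroE by blast
  with assms show False by (simp add: monic_over_def)
qed

text \<open>The characteristic polynomial is a monic equation for the eigenvalue; being the
  determinant of a matrix of polynomials over \<open>R\<close>, it has coefficients in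
  \<open>R\<close>.\<close>

lemma integral_over_eigenvalue:
  fixes A :: "'a::field mat"
  assumes "is_subring R" "A \<in> carrier_mat n n"
    and "\<And>i j. i < n \<Longrightarrow> j < n \<Longrightarrow> A $$ (i, j) \<in> R" "eigenvalue A z"
  shows "integral_over R z"
proof -
  have "char_poly A \<in> {p. \<forall>i. coeff p i \<in> R}"
    unfolding char_poly_def
  proof (rule det_in_subring[OF is_subring_polys[OF assms(1)] char_poly_matrix_closed[OF assms(2)]])
    fix i j assume ij: "i < n" "j < n"
    then have "char_poly_matrix A $$ (i, j) = [:- (A $$ (i, j)), if i = j then 1 else 0:]"
      using assms(2) by (auto simp: char_poly_matrix_def)
    then show "char_poly_matrix A $$ (i, j) \<in> {p. \<forall>i. coeff p i \<in> R}"
      using is_subringD[OF assms(1)] assms(3)[OF ij] by (auto simp: coeff_pCons split: nat.splits)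
  qed
  moreover have "lead_coeff (char_poly A) = 1"
    using degree_monic_char_poly[OF assms(2)] by simp
  moreover have "poly (char_poly A) z = 0"
    using assms(4) eigenvalue_root_char_poly[OF assms(2)] by simp
  ultimately show ?thesis unfolding integral_over_def monic_over_def by blast
qed

section \<open>Finitely generated modules and sums and products of integral elements\<close>

text \<open>This is the \<open>R\<close>-module generated by a finite \<open>W\<close>; for infinite
  \<open>W\<close> the sum is 0 by convention.\<close>

definition fin_span :: "'a::comm_ring_1 set \<Rightarrow> 'a set \<Rightarrow> 'a set" where
  "fin_span R W = {\<Sum>w\<in>W. c w * w | c. \<forall>w\<in>W. c w \<in> R}"

lemma fin_span_add:
  assumes "is_subring R" "u \<in> fin_span R W" "v \<in> fin_span R W"
  shows "u + v \<in> fin_span R W"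
proof -
  obtain c d where "u = (\<Sum>w\<in>W. c w * w)" "v = (\<Sum>w\<in>W. d w * w)" "\<forall>w\<in>W. c w \<in> R" "\<forall>w\<in>W. d w \<in> R"
    using assms(2,3) unfolding fin_span_def by blast
  then show ?thesis unfolding fin_span_def
    using is_subringD(4)[OF assms(1)]
    by (intro CollectI exI[of _ "\<lambda>w. c w + d w"]) (auto simp: sum.distrib algebra_simps)
qed

lemma fin_span_scale:
  assumes "is_subring R" "r \<in> R" "u \<in> fin_span R W"
  shows "r * u \<in> fin_span R W"
proof -
  obtain c where "u = (\<Sum>w\<in>W. c w * w)" "\<forall>w\<in>W. c w \<in> R"
    using assms(3) unfolding fin_span_def by blast
  then show ?thesis unfolding fin_span_def
    using is_subringD(5)[OF assms(1) assms(2)]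
    by (intro CollectI exI[of _ "\<lambda>w. r * c w"]) (auto simp: sum_distrib_left mult.assoc)
qed

lemma fin_span_base:
  assumes "is_subring R" "finite W" "w \<in> W"
  shows "w \<in> fin_span R W"
proof -
  have "(\<Sum>v\<in>W. (if v = w then 1 else 0) * v) = w"
    using assms(2,3) by (simp add: if_distrib[of "\<lambda>x. x * _"] cong: if_cong)
  then show ?thesis unfolding fin_span_def
    using is_subringD(1,2)[OF assms(1)]
    by (intro CollectI exI[of _ "\<lambda>v. if v = w then 1 else 0"]) auto
qed

lemma fin_span_sum:
  assumes "is_subring R" "\<And>i. i \<in> I \<Longrightarrow> f i \<in> fin_span R W"
  shows "sum f I \<in> fin_span R W"
proof -
  have "0 \<in> fin_span R W"
    using is_subringD(1)[OF assms(1)] unfolding fin_span_def by (auto intro!: exI[of _ "\<lambda>_. 0"])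
  with assms(2) show ?thesis
    by (induction I rule: infinite_finite_induct) (auto intro: fin_span_add[OF assms(1)])
qed

text \<open>Multiplication by \<open>z\<close> is \<open>R\<close>-linear, so stability needs
  checking on generators only.\<close>

lemma fin_span_mult_closed:
  assumes "is_subring R" "\<And>w. w \<in> W \<Longrightarrow> z * w \<in> fin_span R W" "u \<in> fin_span R W"
  shows "z * u \<in> fin_span R W"
proof -
  obtain c where c: "u = (\<Sum>w\<in>W. c w * w)" "\<forall>w\<in>W. c w \<in> R"
    using assms(3) unfolding fin_span_def by blast
  have "z * u = (\<Sum>w\<in>W. c w * (z * w))"
    unfolding c(1) by (simp add: sum_distrib_left algebra_simps)
  also have "\<dots> \<in> fin_span R W"
    using c(2) assms(2) by (auto intro!: fin_span_sum[OF assms(1)] intro: fin_span_scale[OF assms(1)])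
  finally show ?thesis .
qed

text \<open>The determinant trick: \<open>z\<close> is an eigenvalue of the matrix over \<open>R\<close> by which it acts on
  the generators \<open>W\<close>.\<close>

lemma integral_over_fin_span:
  fixes z :: "'a::field"
  assumes "is_subring R" "finite W" "w0 \<in> W" "w0 \<noteq> 0"
    and "\<And>w. w \<in> W \<Longrightarrow> z * w \<in> fin_span R W"
  shows "integral_over R z"
proof -
  define n where "n = card W"
  obtain h where h: "bij_betw h {0..<n} W"
    using ex_bij_betw_nat_finite[OF assms(2)] unfolding n_def by blast
  have "\<forall>w\<in>W. \<exists>c. z * w = (\<Sum>v\<in>W. c v * v) \<and> (\<forall>v\<in>W. c v \<in> R)"
    using assms(5) unfolding fin_span_def by blast
  then obtain c where c: "\<And>w. w \<in> W \<Longrightarrow> z * w = (\<Sum>v\<in>W. c w v * v)"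
      "\<And>w v. w \<in> W \<Longrightarrow> v \<in> W \<Longrightarrow> c w v \<in> R"
    by metis
  have hW: "h i \<in> W" if "i < n" for i
    using bij_betwE[OF h] that by auto
  \<comment> \<open>Row \<open>i\<close> of \<open>A\<close> expresses \<open>z * h i\<close> in the
    generators, so the vector of all generators is an eigenvector for \<open>z\<close>.\<close>
  define A where "A = mat n n (\<lambda>(i, j). c (h i) (h j))"
  define v where "v = vec n h"
  have A: "A \<in> carrier_mat n n" by (simp add: A_def)
  obtain i0 where i0: "i0 < n" "h i0 = w0"
    using h assms(3) unfolding bij_betw_def by auto
  have "A *\<^sub>v v = z \<cdot>\<^sub>v v"
  proof (rule eq_vecI)
    fix i assume "i < dim_vec (z \<cdot>\<^sub>v v)"
    then have i: "i < n" by (simp add: v_def)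
    have "(A *\<^sub>v v) $ i = (\<Sum>j = 0..<n. c (h i) (h j) * h j)"
      using i by (simp add: A_def v_def scalar_prod_def)
    also have "\<dots> = (\<Sum>w\<in>W. c (h i) w * w)"
      by (rule sum.reindex_bij_betw[OF h])
    also have "\<dots> = z * h i" using c(1)[OF hW[OF i]] by simp
    finally show "(A *\<^sub>v v) $ i = (z \<cdot>\<^sub>v v) $ i" using i by (simp add: v_def)
  qed (simp add: A_def v_def)
  \<comment> \<open>The nonzero generator \<open>w0\<close> occurs as coordinate
    \<open>i0\<close>.\<close>
  moreover have "v \<noteq> 0\<^sub>v n"
    using i0 assms(4) by (metis index_vec index_zero_vec(1) v_def)
  ultimately have "eigenvalue A z"
    unfolding eigenvalue_def eigenvector_def by (intro exI[of _ v]) (simp add: v_def A_def)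
  then show ?thesis
    using integral_over_eigenvalue[OF assms(1) A] hW c(2) by (simp add: A_def)
qed

text \<open>If the exponent reaches the degree of \<open>p\<close>, the monic equation rewrites the
  top power by lower ones. The factor \<open>u\<close> is meant for a power of a second integral
  element.\<close>

lemma fin_span_power_step:
  assumes "is_subring R" "monic_over R p" "poly p x = 0"
    and "\<And>i. i < degree p \<Longrightarrow> x ^ i * u \<in> fin_span R W" "i < degree p"
  shows "x * (x ^ i * u) \<in> fin_span R W"
proof (cases "Suc i < degree p")
  case True
  then show ?thesis using assms(4)[of "Suc i"] by (simp add: mult.assoc)
next
  case False
  with assms(5) have m: "degree p = Suc i" by simp
  have "0 = (\<Sum>j\<le>degree p. coeff p j * x ^ j)"
    using assms(3) by (simp add: poly_altdef)
  also have "\<dots> = (\<Sum>j<degree p. coeff p j * x ^ j) + x ^ degree p"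
    using assms(2) by (simp add: monic_over_def flip: lessThan_Suc_atMost)
  finally have pow: "x ^ degree p = - (\<Sum>j<degree p. coeff p j * x ^ j)"
    by (metis add_eq_0_iff)
  have "x * (x ^ i * u) = x ^ degree p * u"
    by (simp add: m mult.assoc)
  also have "\<dots> = (\<Sum>j<degree p. (- coeff p j) * (x ^ j * u))"
    unfolding pow by (simp only: minus_mult_left[symmetric] sum_negf sum_distrib_right mult.assoc)
  also have "\<dots> \<in> fin_span R W"
    using assms(2,4) is_subringD(3)[OF assms(1)]
    by (auto simp: monic_over_def simp del: mult_minus_left
        intro!: fin_span_sum[OF assms(1)] intro: fin_span_scale[OF assms(1)])
  finally show ?thesis .
qed

text \<open>The products of powers of \<open>x\<close> and \<open>y\<close> below the degrees of
  their equations span a module stable under multiplication by \<open>x\<close> and by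
  \<open>y\<close>, hence by \<open>x + y\<close> and \<open>x * y\<close>; the determinant trick
  applies to both.\<close>

lemma integral_over_add_mult:
  fixes x y :: "'a::field"
  assumes R: "is_subring R" and "integral_over R x" "integral_over R y"
  shows "integral_over R (x + y)" "integral_over R (x * y)"
proof -
  obtain p q where p: "monic_over R p" "poly p x = 0" and q: "monic_over R q" "poly q y = 0"
    using assms(2,3) unfolding integral_over_def by blast
  define W where "W = (\<lambda>(i, j). x ^ i * y ^ j) ` ({..<degree p} \<times> {..<degree q})"
  let ?M = "fin_span R W"
  have fin: "finite W" by (simp add: W_def)
  \<comment> \<open>The exponents \<open>(0, 0)\<close> are allowed because both degrees are
    positive; 1 serves as the nonzero generator.\<close>
  have one: "1 \<in> W"
    using monic_over_degree_pos[OF p] monic_over_degree_pos[OF q]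
    unfolding W_def by (intro image_eqI[of _ _ "(0, 0)"]) auto
  have base: "x ^ i * y ^ j \<in> ?M" if "i < degree p" "j < degree q" for i j
    using that by (intro fin_span_base[OF R fin]) (auto simp: W_def)
  have x: "x * w \<in> ?M" if w: "w \<in> W" for w
  proof -
    obtain i j where ij: "i < degree p" "j < degree q" "w = x ^ i * y ^ j"
      using w unfolding W_def by auto
    show ?thesis
      using fin_span_power_step[OF R p, of "y ^ j"] base ij by simp
  qed
  have y: "y * w \<in> ?M" if w: "w \<in> W" for w
  proof -
    obtain i j where ij: "i < degree p" "j < degree q" "w = x ^ i * y ^ j"
      using w unfolding W_def by auto
    show ?thesis
      using fin_span_power_step[OF R q, of "x ^ i"] base ij by (simp add: mult.commute)
  qed
  show "integral_over R (x + y)"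
    using x y by (intro integral_over_fin_span[OF R fin one])
      (auto simp: distrib_right intro: fin_span_add[OF R])
  show "integral_over R (x * y)"
    using x y by (intro integral_over_fin_span[OF R fin one])
      (auto simp: mult.assoc intro: fin_span_mult_closed[OF R])
qed

lemma integral_over_base:
  assumes "is_subring R" "r \<in> R"
  shows "integral_over R r"
  unfolding integral_over_def monic_over_def
  using is_subringD[OF assms(1)] assms(2)
  by (intro exI[of _ "[:- r, 1:]"]) (auto simp: coeff_pCons split: nat.splits)

lemma is_subring_integral_closure:
  fixes R :: "'a::field set"
  assumes "is_subring R"
  shows "is_subring {x. integral_over R x}"
proof -
  have "integral_over R (- x)" if "integral_over R x" for x
    using integral_over_add_mult(2)[OF assms integral_over_base[OF assms, of "- 1"] that]
      is_subringD(2,3)[OF assms] by simp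
  then show ?thesis
    using integral_over_add_mult[OF assms] integral_over_base[OF assms] is_subringD(1,2)[OF assms]
    unfolding is_subring_def by auto
qed

section \<open>Transport along injective homomorphisms\<close>

lemma monic_over_map_poly:
  assumes "inj_comm_ring_hom h" "monic_over R p"
  shows "monic_over (h ` R) (map_poly h p)"
proof -
  interpret inj_comm_ring_hom h by fact
  show ?thesis using assms(2) by (auto simp: monic_over_def)
qed

text \<open>Coefficients in the image are pulled back one by one, and injectivity makes the leading
  coefficient 1 again.\<close>

lemma monic_over_image_conv:
  assumes "inj_comm_ring_hom h"
  shows "monic_over (h ` R) q \<longleftrightarrow> (\<exists>p. monic_over R p \<and> q = map_poly h p)"
proof
  interpret inj_comm_ring_hom h by fact
  assume q: "monic_over (h ` R) q"
  \<comment> \<open>Injectivity makes \<open>h'\<close> a left inverse of \<open>h\<close>. It sends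
    0 to 0, so \<open>map_poly\<close> acts coefficientwise.\<close>
  define h' where "h' = inv_into UNIV h"
  have inv: "h' (h r) = r" for r
    unfolding h'_def using injectivity by (intro inv_f_f injI)
  have inv0: "h' 0 = 0" using inv[of 0] by simp
  define p where "p = map_poly h' q"
  have p: "coeff p i = h' (coeff q i)" for i
    by (simp add: p_def coeff_map_poly inv0)
  have cq: "coeff q i \<in> h ` R" for i using q by (simp add: monic_over_def)
  have qp: "q = map_poly h p"
  proof (rule poly_eqI)
    fix i show "coeff q i = coeff (map_poly h p) i"
      using cq[of i] inv by (auto simp: p)
  qed
  have "coeff p i \<in> R" for i
    using cq[of i] inv by (auto simp: p)
  moreover have "lead_coeff p = 1"
  proof -
    have "h (lead_coeff p) = h 1" using q by (simp add: qp monic_over_def)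
    then show ?thesis using injectivity by blast
  qed
  ultimately show "\<exists>p. monic_over R p \<and> q = map_poly h p"
    using qp unfolding monic_over_def by blast
qed (use monic_over_map_poly[OF assms] in blast)

text \<open>Integrality and integral degree are both built from this condition, so both transfer
  along \<open>h\<close>.\<close>

lemma monic_root_image_iff:
  assumes "inj_comm_ring_hom h"
  shows "(\<exists>q. monic_over (h ` R) q \<and> degree q = n \<and> poly q (h x) = 0) \<longleftrightarrow>
    (\<exists>p. monic_over R p \<and> degree p = n \<and> poly p x = 0)"
proof -
  interpret inj_comm_ring_hom h by fact
  have "degree (map_poly h p) = degree p" "poly (map_poly h p) (h x) = 0 \<longleftrightarrow> poly p x = 0" for p
    by (simp_all)
  then show ?thesis unfolding monic_over_image_conv[OF assms] by metis
qed

lemma integral_over_image_iff: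
  assumes "inj_comm_ring_hom h"
  shows "integral_over (h ` R) (h x) \<longleftrightarrow> integral_over R x"
  using monic_root_image_iff[OF assms, of R _ x] unfolding integral_over_def by blast

lemma int_degree_image:
  assumes "inj_comm_ring_hom h"
  shows "int_degree (h ` R) (h x) = int_degree R x"
  unfolding int_degree_def monic_root_image_iff[OF assms] ..

lemma inj_comm_ring_hom_to_ac: "inj_comm_ring_hom to_ac"
  by unfold_locales auto

lemma inj_comm_ring_hom_to_fract: "inj_comm_ring_hom to_fract"
  by unfold_locales auto

section \<open>Coefficients of monic factors\<close>

text \<open>The roots of \<open>g\<close> in the algebraic closure are roots of \<open>f\<close>,
  hence integral over the image of \<open>R\<close>. So are the coefficients of \<open>g\<close>,
  and their integrality descends along \<open>to_ac\<close>.\<close>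

lemma monic_factor_coeffs_integral:
  fixes f g :: "'a::field poly"
  assumes "is_subring R" "monic_over R f" "lead_coeff g = 1" "g dvd f"
  shows "integral_over R (coeff g i)"
proof -
  interpret inj_comm_ring_hom "to_ac :: 'a \<Rightarrow> _" by (rule inj_comm_ring_hom_to_ac)
  interpret P: map_poly_comm_ring_hom "to_ac :: 'a \<Rightarrow> _" ..
  let ?h = "map_poly (to_ac :: 'a \<Rightarrow> _)"
  let ?S = "{x. integral_over (to_ac ` R) x}"
  have S: "is_subring ?S"
    by (intro is_subring_integral_closure is_subring_image inj_comm_ring_hom_to_ac assms)
  have lead: "lead_coeff (?h g) = 1" using assms(3) by simp
  then have "?h g \<noteq> 0" by auto
  \<comment> \<open>Over the algebraic closure the polynomial splits; as it is monic, no scalar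
    factor remains.\<close>
  from alg_closed_imp_factorization[OF this] lead
  obtain M where M: "?h g = (\<Prod>x\<in>#M. [:- x, 1:])" by auto
  have dvd: "?h g dvd ?h f"
    using assms(4) by (auto simp: P.hom_mult)
  have "x \<in> ?S" if "x \<in># M" for x
  proof -
    have "[:- x, 1:] dvd ?h g"
      unfolding M using that by (intro dvd_prod_mset) auto
    then have "poly (?h f) x = 0"
      using dvd dvd_trans poly_eq_0_iff_dvd by blast
    then show ?thesis
      using monic_over_map_poly[OF inj_comm_ring_hom_to_ac assms(2)]
      unfolding integral_over_def by blast
  qed
  \<comment> \<open>Each linear factor has coefficients in \<open>?S\<close>, and polynomials over
    \<open>?S\<close> are closed under products.\<close>
  then have "?h g \<in> {p. \<forall>i. coeff p i \<in> ?S}"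
    unfolding M using is_subringD[OF S]
    by (intro is_subring_prod_mset is_subring_polys S) (auto simp: coeff_pCons split: nat.splits)
  then have "integral_over (to_ac ` R) (to_ac (coeff g i))" by auto
  then show ?thesis by (simp add: integral_over_image_iff[OF inj_comm_ring_hom_to_ac])
qed

section \<open>Integral degree\<close>

lemma int_degree_le:
  assumes "monic_over R p" "poly p b = 0"
  shows "int_degree R b \<le> degree p"
  unfolding int_degree_def
  using monic_over_degree_pos[OF assms] assms by (intro Least_le) auto

lemma int_degree_witness:
  assumes "integral_over R b"
  obtains p where "monic_over R p" "degree p = int_degree R b" "poly p b = 0"
proof -
  obtain p where "monic_over R p" "poly p b = 0" using assms unfolding integral_over_def by blast
  then have "\<exists>n. 1 \<le> n \<and> (\<exists>p. monic_over R p \<and> degree p = n \<and> poly p b = 0)"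
    using monic_over_degree_pos[of R p b] by (intro exI[of _ "degree p"]) auto
  from LeastI_ex[OF this] show ?thesis using that unfolding int_degree_def by blast
qed

lemma monic_over_mono: "monic_over R p \<Longrightarrow> R \<subseteq> R' \<Longrightarrow> monic_over R' p"
  unfolding monic_over_def by auto

text \<open>A minimal equation over \<open>R\<close> is also one over \<open>R'\<close>; integrality
  over \<open>R\<close> guarantees that it exists.\<close>

lemma int_degree_antimono:
  assumes "integral_over R b" "R \<subseteq> R'"
  shows "int_degree R' b \<le> int_degree R b"
  using int_degree_witness[OF assms(1)] int_degree_le monic_over_mono[OF _ assms(2)] by metis

text \<open>This is long division carried out by strong induction. Since \<open>K\<close> is a set
  inside the ambient field, each step has to keep the coefficients in \<open>K\<close>.\<close>

lemma min_degree_dvd: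
  fixes f g :: "'a::field poly"
  assumes K: "is_subring K" "\<And>x. x \<in> K \<Longrightarrow> inverse x \<in> K"
    and g: "monic_over K g" "degree g = int_degree K c" "poly g c = 0"
    and f: "\<forall>i. coeff f i \<in> K" "poly f c = 0"
  shows "g dvd f"
  using f
proof (induction "degree f" arbitrary: f rule: less_induct)
  case less
  show ?case
  proof (cases "f = 0")
    case False
    define a where "a = lead_coeff f"
    have a: "a \<noteq> 0" "a \<in> K" using False less.prems by (auto simp: a_def)
    \<comment> \<open>Normalizing \<open>f\<close> yields a monic competitor of \<open>g\<close>, so
      minimality gives the degree bound that permits a division step.\<close>
    have "monic_over K (smult (inverse a) f)"
      using a less.prems is_subringD(5)[OF K(1)] K(2) by (auto simp: monic_over_def a_def)
    from int_degree_le[OF this, of c] have le: "degree g \<le> degree f"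
      using less.prems g(2) a by simp
    \<comment> \<open>This monomial makes \<open>q * g\<close> agree with \<open>f\<close> in its
      leading term, so \<open>f'\<close> is zero or of smaller degree.\<close>
    define q where "q = monom a (degree f - degree g)"
    define f' where "f' = f - q * g"
    have gne: "g \<noteq> 0" using g(1) by (auto simp: monic_over_def)
    have degq: "degree (q * g) = degree f"
      using gne a le by (simp add: q_def degree_mult_eq degree_monom_eq)
    have "coeff (q * g) (degree f) = lead_coeff q * lead_coeff g"
      unfolding degq[symmetric] by (rule lead_coeff_mult)
    also have "\<dots> = a"
      using g(1) a(1) by (simp add: q_def monic_over_def degree_monom_eq)
    finally have "coeff f' (degree f) = 0" by (simp add: f'_def a_def)
    moreover have "degree f' \<le> degree f"
      unfolding f'_def using degq by (intro degree_diff_le) auto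
    ultimately have dis: "f' = 0 \<or> degree f' < degree f"
      by (intro eq_zero_or_degree_less)
    have "f' \<in> {p. \<forall>i. coeff p i \<in> K}"
      unfolding f'_def
      using less.prems(1) g(1) a is_subringD(1)[OF K(1)]
      by (intro is_subring_diff is_subringD(5) is_subring_polys K(1))
        (auto simp: q_def monic_over_def)
    moreover have "poly f' c = 0" using less.prems(2) g(3) by (simp add: f'_def)
    ultimately have "g dvd f'" using dis less.hyps[of f'] by auto
    then have "g dvd f' + q * g" by simp
    then show ?thesis by (simp add: f'_def)
  qed simp
qed

text \<open>If \<open>p\<close> is monic of degree \<open>n\<close> with root \<open>z\<close>, then
  \<open>p(a T) / a^n\<close> is monic of the same degree with root \<open>z / a\<close>.\<close>

lemma int_degree_divide_le:
  fixes z a :: "'a::field"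
  assumes K: "is_subring K" "\<And>x. x \<in> K \<Longrightarrow> inverse x \<in> K"
    and "integral_over K z" "a \<in> K" "a \<noteq> 0"
  shows "int_degree K (z / a) \<le> int_degree K z"
proof -
  obtain p where p: "monic_over K p" "degree p = int_degree K z" "poly p z = 0"
    using int_degree_witness[OF assms(3)] .
  have pow: "x ^ i \<in> K" if "x \<in> K" for x i
    using that is_subringD(2,5)[OF K(1)] by (induction i) auto
  define q where "q = smult (inverse a ^ degree p) (pcompose p [:0, a:])"
  have deg: "degree q = degree p" using assms(5) by (simp add: q_def degree_pcompose)
  have cq: "coeff q i = inverse a ^ degree p * (a ^ i * coeff p i)" for i
    by (simp add: q_def coeff_pcompose_linear)
  have "monic_over K q"
    unfolding monic_over_def deg cq
  proof (intro conjI allI)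
    show "inverse a ^ degree p * (a ^ i * coeff p i) \<in> K" for i
      using p(1) pow K(2) assms(4) by (intro is_subringD(5)[OF K(1)]) (auto simp: monic_over_def)
    show "inverse a ^ degree p * (a ^ degree p * coeff p (degree p)) = 1"
      using p(1) assms(5) by (simp add: monic_over_def power_inverse)
  qed
  moreover have "poly q (z / a) = 0" using p(3) assms(5) by (simp add: q_def poly_pcompose)
  ultimately show ?thesis using int_degree_le deg p(2) by metis
qed

section \<open>Fraction fields\<close>

lemma fraction_field_conv:
  "fraction_field R = {to_fract x / to_fract y | x y. x \<in> R \<and> y \<in> R \<and> y \<noteq> 0}"
  unfolding fraction_field_def by (auto simp: Fract_conv_to_fract)

lemma to_fract_in_fraction_field:
  assumes "is_subring R" "x \<in> R"
  shows "to_fract x \<in> fraction_field R"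
  unfolding fraction_field_conv using is_subringD(2)[OF assms(1)] assms(2)
  by (intro CollectI exI[of _ x] exI[of _ 1]) auto

lemma inverse_in_fraction_field:
  assumes "is_subring R" "u \<in> fraction_field R"
  shows "inverse u \<in> fraction_field R"
proof -
  obtain x y where xy: "u = to_fract x / to_fract y" "x \<in> R" "y \<in> R" "y \<noteq> 0"
    using assms(2) unfolding fraction_field_conv by blast
  show ?thesis
  proof (cases "x = 0")
    \<comment> \<open>Here \<open>u = 0\<close>, and \<open>inverse 0 = 0\<close> by
      convention.\<close>
    case True
    then show ?thesis using assms(2) xy by simp
  next
    case False
    then show ?thesis using xy unfolding fraction_field_conv
      by (intro CollectI exI[of _ y] exI[of _ x]) auto
  qed
qed

lemma is_subring_fraction_field:
  assumes "is_subring R"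
  shows "is_subring (fraction_field R)"
  unfolding is_subring_def
proof (intro conjI ballI)
  show "0 \<in> fraction_field R" "1 \<in> fraction_field R"
    using to_fract_in_fraction_field[OF assms] is_subringD(1,2)[OF assms] by (metis to_fract_0, metis to_fract_1)
next
  fix u assume "u \<in> fraction_field R"
  then obtain x y where xy: "u = to_fract x / to_fract y" "x \<in> R" "y \<in> R" "y \<noteq> 0"
    unfolding fraction_field_conv by blast
  then show "- u \<in> fraction_field R"
    unfolding fraction_field_conv using is_subringD(3)[OF assms]
    by (intro CollectI exI[of _ "- x"] exI[of _ y]) auto
  fix v assume "v \<in> fraction_field R"
  then obtain x' y' where xy': "v = to_fract x' / to_fract y'" "x' \<in> R" "y' \<in> R" "y' \<noteq> 0"
    unfolding fraction_field_conv by blast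
  show "u * v \<in> fraction_field R"
    unfolding fraction_field_conv using is_subringD(5)[OF assms] xy xy'
    by (intro CollectI exI[of _ "x * x'"] exI[of _ "y * y'"]) auto
  show "u + v \<in> fraction_field R"
    unfolding fraction_field_conv using is_subringD(4,5)[OF assms] xy xy'
    by (intro CollectI exI[of _ "x * y' + x' * y"] exI[of _ "y * y'"]) (auto simp: add_frac_eq)
qed

section \<open>Denominators in the base ring\<close>

lemma poly_in_subring:
  assumes "is_subring S" "\<forall>i. coeff p i \<in> S" "x \<in> S"
  shows "poly p x \<in> S"
  using assms(2)
proof (induction p)
  case (pCons a p)
  have "a \<in> S" "\<forall>i. coeff p i \<in> S"
    using pCons.prems by (metis coeff_pCons_0, metis coeff_pCons_Suc)
  then show ?case using pCons.IH is_subringD(4,5)[OF assms(1)] assms(3) by simp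
qed (use is_subringD(1)[OF assms(1)] in simp)

text \<open>Up to its sign, the multiple is the lowest nonzero coefficient of an integral equation
  of \<open>y\<close>.\<close>

lemma integral_nonzero_multiple:
  fixes y :: "'a::idom"
  assumes S: "is_subring S" "R \<subseteq> S" and y: "y \<in> S" "y \<noteq> 0" "integral_over R y"
  shows "\<exists>s\<in>S. y * s \<in> R - {0}"
proof -
  obtain p where "monic_over R p" "poly p y = 0" using y(3) unfolding integral_over_def by blast
  then show ?thesis
  proof (induction p)
    case 0
    then show ?case by (simp add: monic_over_def)
  next
    case (pCons a q)
    have q: "\<forall>i. coeff q i \<in> R" and a: "a \<in> R"
      using pCons.prems(1) unfolding monic_over_def by (metis coeff_pCons_Suc, metis coeff_pCons_0)
    show ?case
    proof (cases "a = 0")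
      case True
      \<comment> \<open>With zero constant term the equation reads \<open>y * poly q y = 0\<close>;
        cancelling the nonzero \<open>y\<close> leaves a monic equation of lower degree.\<close>
      then have "q \<noteq> 0" using pCons.hyps by simp
      then have "monic_over R q" using pCons.prems(1) q by (simp add: monic_over_def)
      moreover have "poly q y = 0" using pCons.prems(2) True y(2) by simp
      ultimately show ?thesis by (rule pCons.IH)
    next
      case False
      have "poly q y \<in> S" using q S y(1) by (intro poly_in_subring) auto
      moreover have "y * (- poly q y) = a"
        using pCons.prems(2) by (simp add: add_eq_0_iff2)
      ultimately show ?thesis
        using False a is_subringD(3)[OF S(1)] by (intro bexI[of _ "- poly q y"]) auto
    qed
  qed
qed

text \<open>The denominator is integral over \<open>A\<close>, so it has a nonzero multiple in
  \<open>A\<close>; the fraction is expanded by the cofactor.\<close>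

lemma fraction_field_denominator_in_base:
  assumes "integral_extension A B" "u \<in> fraction_field B"
  obtains z a where "z \<in> B" "a \<in> A" "a \<noteq> 0" "u = to_fract z / to_fract a"
proof -
  have B: "is_subring B" "A \<subseteq> B" using assms(1) unfolding integral_extension_def by auto
  obtain x y where xy: "u = to_fract x / to_fract y" "x \<in> B" "y \<in> B" "y \<noteq> 0"
    using assms(2) unfolding fraction_field_conv by blast
  have "integral_over A y" using assms(1) xy(3) unfolding integral_extension_def by blast
  from integral_nonzero_multiple[OF B xy(3,4) this]
  obtain s where s: "s \<in> B" "y * s \<in> A" "y * s \<noteq> 0" by auto
  have "u = to_fract (x * s) / to_fract (y * s)" using s(3) by (simp add: xy(1))
  with that[of "x * s" "y * s"] show thesis
    using s is_subringD(5)[OF B(1) xy(2)] by blast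
qed

lemma to_fract_image_subset_normalization:
  assumes "is_subring A"
  shows "to_fract ` A \<subseteq> normalization_of A"
  unfolding normalization_of_def integral_closure_in_def
  using to_fract_in_fraction_field[OF assms] is_subring_image[OF inj_comm_ring_hom_to_fract assms]
  by (auto intro: integral_over_base)

section \<open>Comparison of integral degrees\<close>

lemma int_degree_fraction_field_eq_normalization:
  assumes "integral_extension A B" "b \<in> B"
  shows "int_degree (fraction_field A) (to_fract b) = int_degree (normalization_of A) (to_fract b)"
proof (rule antisym)
  let ?K = "fraction_field A" and ?N = "normalization_of A" and ?c = "to_fract b"
  have A: "is_subring A" using assms(1) unfolding integral_extension_def by blast
  have K: "is_subring ?K" "\<And>x. x \<in> ?K \<Longrightarrow> inverse x \<in> ?K"
    by (auto intro: is_subring_fraction_field inverse_in_fraction_field A)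
  have tA: "is_subring (to_fract ` A)"
    by (rule is_subring_image[OF inj_comm_ring_hom_to_fract A])
  have sub: "to_fract ` A \<subseteq> ?N" "?N \<subseteq> ?K"
    using to_fract_image_subset_normalization[OF A]
    by (auto simp: normalization_of_def integral_closure_in_def)
  have "integral_over A b" using assms unfolding integral_extension_def by blast
  then have "integral_over (to_fract ` A) ?c"
    by (simp add: integral_over_image_iff[OF inj_comm_ring_hom_to_fract])
  then obtain f where f: "monic_over (to_fract ` A) f" "poly f ?c = 0"
    unfolding integral_over_def by blast
  have fN: "monic_over ?N f" by (rule monic_over_mono[OF f(1) sub(1)])
  then have fK: "monic_over ?K f" by (rule monic_over_mono[OF _ sub(2)])
  show "int_degree ?K ?c \<le> int_degree ?N ?c"
    using fN f(2) by (intro int_degree_antimono[OF _ sub(2)]) (auto simp: integral_over_def)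
  have "integral_over ?K ?c" using fK f(2) unfolding integral_over_def by blast
  from int_degree_witness[OF this]
  obtain g where g: "monic_over ?K g" "degree g = int_degree ?K ?c" "poly g ?c = 0" .
  \<comment> \<open>Divisibility by the minimal \<open>g\<close> over \<open>?K\<close> makes the
    coefficients of \<open>g\<close> inherit integrality from \<open>f\<close>, whose coefficients
    come from \<open>A\<close>.\<close>
  have "g dvd f"
    using fK f(2) by (intro min_degree_dvd[OF K g]) (auto simp: monic_over_def)
  then have "integral_over (to_fract ` A) (coeff g i)" for i
    using g(1) by (intro monic_factor_coeffs_integral[OF tA f(1)]) (auto simp: monic_over_def)
  \<comment> \<open>Lying in \<open>?K\<close> and being integral over the image of \<open>A\<close>
    is exactly membership in \<open>?N\<close>.\<close>
  then have "monic_over ?N g"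
    using g(1) by (auto simp: monic_over_def normalization_of_def integral_closure_in_def)
  from int_degree_le[OF this g(3)] show "int_degree ?N ?c \<le> int_degree ?K ?c"
    by (simp add: g(2))
qed

lemma ext_int_degree_fraction_fields:
  assumes "integral_extension A B" "integrally_closed A"
  shows "ext_int_degree (fraction_field A) (fraction_field B) = ext_int_degree A B"
proof -
  let ?K = "fraction_field A" and ?L = "fraction_field B"
  have A: "is_subring A" and B: "is_subring B"
    using assms(1) unfolding integral_extension_def by blast+
  have K: "is_subring ?K" "\<And>x. x \<in> ?K \<Longrightarrow> inverse x \<in> ?K"
    by (auto intro: is_subring_fraction_field inverse_in_fraction_field A)
  \<comment> \<open>For integrally closed \<open>A\<close> the normalization is the image of
    \<open>A\<close>, and degrees over that image are degrees over \<open>A\<close>.\<close>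
  have deg: "int_degree ?K (to_fract b) = int_degree A b" if "b \<in> B" for b
    using int_degree_fraction_field_eq_normalization[OF assms(1) that] assms(2)
    int_degree_image[OF inj_comm_ring_hom_to_fract, of A b]
    by (simp add: integrally_closed_def)
  show ?thesis unfolding ext_int_degree_def
  proof (rule antisym)
    show "(SUP u\<in>?L. enat (int_degree ?K u)) \<le> (SUP b\<in>B. enat (int_degree A b))"
    proof (rule SUP_mono)
      fix u assume "u \<in> ?L"
      from fraction_field_denominator_in_base[OF assms(1) this]
      obtain z a where za: "z \<in> B" "a \<in> A" "a \<noteq> 0" "u = to_fract z / to_fract a" .
      have "integral_over (to_fract ` A) (to_fract z)"
        using assms(1) za(1) unfolding integral_extension_def
        by (simp add: integral_over_image_iff[OF inj_comm_ring_hom_to_fract])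
      then have "integral_over ?K (to_fract z)"
        using monic_over_mono[of "to_fract ` A" _ ?K] to_fract_in_fraction_field[OF A]
        unfolding integral_over_def by (metis image_subsetI)
      \<comment> \<open>Dividing by an element of \<open>?K\<close> does not raise the degree, so
        the numerator \<open>z\<close> from \<open>B\<close> dominates \<open>u\<close>.\<close>
      then have "int_degree ?K u \<le> int_degree ?K (to_fract z)"
        unfolding za(4) using za(2,3) to_fract_in_fraction_field[OF A]
        by (intro int_degree_divide_le K) auto
      then show "\<exists>b\<in>B. enat (int_degree ?K u) \<le> enat (int_degree A b)"
        using deg za(1) by auto
    qed
    show "(SUP b\<in>B. enat (int_degree A b)) \<le> (SUP u\<in>?L. enat (int_degree ?K u))"
      using deg to_fract_in_fraction_field[OF B] by (intro SUP_mono) (metis order_refl)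
  qed
qed

theorem proposition6p1:
  fixes A B :: "'a::idom set" and K L :: "'a fract set"
  assumes "integral_extension A B"
    and "K = fraction_field A"
    and "L = fraction_field B"
  shows "(\<forall>b\<in>B. int_degree K (to_fract b) = int_degree (normalization_of A) (to_fract b)) \<and>
    (integrally_closed A \<longrightarrow> ext_int_degree K L = ext_int_degree A B)"
  using int_degree_fraction_field_eq_normalization[OF assms(1)]
    ext_int_degree_fraction_fields[OF assms(1)] assms(2,3) by simp

end
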